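(* Let $X$ be a reflexive complex Banach space. Every weakly sequentially continuous function $f:X\to\mathbb{C}$ which is bounded on $B_X$ attains the $s$-norm for every $s\in(0,1]$. In particular, such an $f$ attains the $v$-norm.
   Context: $B_X$ is the open unit ball of $X$ and $\overline{B_X}$ the closed unit ball. A function $f$ is weakly sequentially continuous if $f(x_n)\to f(x)$ whenever $x_n\to x$ weakly. For $s\in(0,1]$, $\|f\|_s=\sup_{x\in B_X}|f(sx)|$, and $\|f\|_v=\sup_{x\in B_X}(1-\|x\|^2)|f(x)|$. The function $f$ attains the $s$-norm if there is $x_0\in s\overline{B_X}$ with $\|f\|_s=|f(x_0)|$; it attains the $v$-norm if there is $x_0\in\overline{B_X}$ with $\|f\|_v=(1-\|x_0\|^2)|f(x_0)|$. *)

theory Defs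
  imports "HOL-Analysis.Analysis"
begin

class complex_vector = real_vector +
  fixes scaleC :: "complex \<Rightarrow> 'a \<Rightarrow> 'a"  (infixr "*\<^sub>C" 75)
  assumes scaleC_add_right: "a *\<^sub>C (x + y) = a *\<^sub>C x + a *\<^sub>C y"
    and scaleC_add_left: "(a + b) *\<^sub>C x = a *\<^sub>C x + b *\<^sub>C x"
    and scaleC_scaleC: "a *\<^sub>C b *\<^sub>C x = (a * b) *\<^sub>C x"
    and scaleC_one: "1 *\<^sub>C x = x"
    and scaleR_scaleC: "r *\<^sub>R x = complex_of_real r *\<^sub>C x"

class complex_normed_vector = complex_vector + real_normed_vector +
  assumes norm_scaleC: "norm (a *\<^sub>C x) = cmod a * norm x"

class complex_banach = complex_normed_vector + banach

definition cdual :: "('a::complex_normed_vector \<Rightarrow> complex) set" where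
  "cdual = {\<phi>. bounded_linear \<phi> \<and> (\<forall>c x. \<phi> (c *\<^sub>C x) = c * \<phi> x)}"

text \<open>The dual is a set of functions normed by \<open>onorm\<close>. An element of the bidual is
  represented by a function on all of \<^typ>\<open>'a \<Rightarrow> complex\<close>, of which only the values on
  \<open>cdual\<close> matter.\<close>

definition cbidual :: "(('a::complex_normed_vector \<Rightarrow> complex) \<Rightarrow> complex) set" where
  "cbidual = {\<Phi>.
     (\<forall>\<phi>\<in>cdual. \<forall>\<psi>\<in>cdual. \<Phi> (\<lambda>x. \<phi> x + \<psi> x) = \<Phi> \<phi> + \<Phi> \<psi>) \<and>
     (\<forall>c. \<forall>\<phi>\<in>cdual. \<Phi> (\<lambda>x. c * \<phi> x) = c * \<Phi> \<phi>) \<and>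
     (\<exists>K. \<forall>\<phi>\<in>cdual. cmod (\<Phi> \<phi>) \<le> K * onorm \<phi>)}"

text \<open>Surjectivity of the canonical embedding into the bidual.\<close>

definition reflexive_space :: "'a::complex_banach itself \<Rightarrow> bool" where
  "reflexive_space _ \<longleftrightarrow>
     (\<forall>\<Phi>\<in>cbidual. \<exists>x::'a. \<forall>\<phi>\<in>cdual. \<Phi> \<phi> = \<phi> x)"

definition weakly_converges :: "(nat \<Rightarrow> 'a::complex_normed_vector) \<Rightarrow> 'a \<Rightarrow> bool" where
  "weakly_converges xs x \<longleftrightarrow> (\<forall>\<phi>\<in>cdual. (\<lambda>n. \<phi> (xs n)) \<longlonglongrightarrow> \<phi> x)"

definition weakly_seq_continuous :: "('a::complex_normed_vector \<Rightarrow> complex) \<Rightarrow> bool" where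
  "weakly_seq_continuous f \<longleftrightarrow>
     (\<forall>xs x. weakly_converges xs x \<longrightarrow> (\<lambda>n. f (xs n)) \<longlonglongrightarrow> f x)"

text \<open>Both suprema are real-valued, hence meaningful only for \<open>f\<close> bounded on the sets
  in question.\<close>

definition s_norm :: "real \<Rightarrow> ('a::complex_normed_vector \<Rightarrow> complex) \<Rightarrow> real" where
  "s_norm s f = (SUP x\<in>ball 0 1. cmod (f (s *\<^sub>R x)))"

definition v_norm :: "('a::complex_normed_vector \<Rightarrow> complex) \<Rightarrow> real" where
  "v_norm f = (SUP x\<in>ball 0 1. (1 - (norm x)\<^sup>2) * cmod (f x))"

definition attains_s_norm :: "real \<Rightarrow> ('a::complex_normed_vector \<Rightarrow> complex) \<Rightarrow> bool" where
  "attains_s_norm s f \<longleftrightarrow>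
     (\<exists>x0 \<in> (\<lambda>x. s *\<^sub>R x) ` cball 0 1. s_norm s f = cmod (f x0))"

definition attains_v_norm :: "('a::complex_normed_vector \<Rightarrow> complex) \<Rightarrow> bool" where
  "attains_v_norm f \<longleftrightarrow>
     (\<exists>x0 \<in> cball 0 1. v_norm f = (1 - (norm x0)\<^sup>2) * cmod (f x0))"

end

theory Submission imports Defs begin

text \<open>By reflexivity and Tychonoff's theorem a bounded sequence has a weak cluster point. A
  diagonal argument over countably many functionals, norming a countable dense subset of the span
  of the sequence, yields a subsequence with only one weak cluster point, which is therefore its
  weak limit. Applied to a maximizing sequence this gives both assertions; for the \<open>v\<close>-norm
  one uses in addition that the norm is weakly lower semicontinuous.\<close>

subsection \<open>The Hahn--Banach theorem\<close>

text \<open>Homogeneity is asked only as an inequality, which is what the infima below deliver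
  directly; equality follows by applying it to the inverse factor as well.\<close>

definition sublinear :: "('a::real_vector \<Rightarrow> real) \<Rightarrow> bool" where
  "sublinear p \<longleftrightarrow>
     (\<forall>x y. p (x + y) \<le> p x + p y) \<and> (\<forall>c\<ge>0. \<forall>x. p (c *\<^sub>R x) \<le> c * p x)"

lemma sublinear_add: "sublinear p \<Longrightarrow> p (x + y) \<le> p x + p y"
  and sublinear_scaleR_le: "sublinear p \<Longrightarrow> c \<ge> 0 \<Longrightarrow> p (c *\<^sub>R x) \<le> c * p x"
  by (auto simp: sublinear_def)

lemma sublinear_zero:
  assumes "sublinear p" shows "p 0 = 0"
  using sublinear_add[OF assms, of 0 0] sublinear_scaleR_le[OF assms, of 0 0] by simp

lemma sublinear_scaleR:
  assumes "sublinear p" "c \<ge> 0" shows "p (c *\<^sub>R x) = c * p x"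
proof (cases "c = 0")
  case True
  then show ?thesis using sublinear_zero[OF assms(1)] by simp
next
  case False
  then have "p x \<le> inverse c * p (c *\<^sub>R x)"
    using sublinear_scaleR_le[OF assms(1), of "inverse c" "c *\<^sub>R x"] assms(2) by simp
  then have "c * p x \<le> p (c *\<^sub>R x)"
    using False assms(2) by (simp add: field_simps)
  then show ?thesis using sublinear_scaleR_le[OF assms, of x] by simp
qed

lemma sublinear_minus_le:
  assumes "sublinear p" shows "- p (- x) \<le> p x"
  using sublinear_add[OF assms, of x "- x"] sublinear_zero[OF assms] by simp

text \<open>Take the infimum over \<open>t \<ge> 0\<close> of
  \<open>p (x + t *\<^sub>R y) - t * p y\<close>: the choice \<open>t = 0\<close> gives
  \<open>q \<le> p\<close>, and \<open>t = 1\<close> at \<open>- y\<close> gives the bound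
  there.\<close>

lemma sublinear_lower:
  fixes y :: "'a::real_vector"
  assumes p: "sublinear p"
  obtains q where "sublinear q" "q \<le> p" "q (- y) \<le> - p y"
proof
  define g where "g x t = p (x + t *\<^sub>R y) - t * p y" for x t
  define q where "q x = (INF t\<in>{0..}. g x t)" for x
  \<comment> \<open>Since \<open>t * p y = p (t *\<^sub>R y) \<le> p (x + t *\<^sub>R y) + p (-
    x)\<close>, the infimum is finite.\<close>
  have "- p (- x) \<le> g x t" if "t \<ge> 0" for x t
    using sublinear_add[OF p, of "x + t *\<^sub>R y" "- x"] sublinear_scaleR[OF p that, of y]
    by (simp add: g_def)
  then have bdd: "bdd_below (g x ` {0..})" for x
    by (auto intro!: bdd_belowI2)
  have q_le: "q x \<le> g x t" if "t \<ge> 0" for x t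
    unfolding q_def using that by (intro cINF_lower[OF bdd]) auto
  have le_q: "m \<le> q x" if "\<And>t. t \<ge> 0 \<Longrightarrow> m \<le> g x t" for m x
    unfolding q_def using that by (intro cINF_greatest) auto
  show "q \<le> p"
    using q_le[of 0] by (auto simp: le_fun_def g_def)
  show "q (- y) \<le> - p y"
    using q_le[of 1 "- y"] sublinear_zero[OF p] by (simp add: g_def)
  show "sublinear q"
    unfolding sublinear_def
  proof (intro conjI allI impI)
    fix x z
    have *: "q (x + z) \<le> g x t + g z s" if "t \<ge> 0" "s \<ge> 0" for t s
    proof -
      have "q (x + z) \<le> g (x + z) (t + s)" using that by (intro q_le) auto
      also have "\<dots> \<le> g x t + g z s"
        using sublinear_add[OF p, of "x + t *\<^sub>R y" "z + s *\<^sub>R y"]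
        by (simp add: g_def algebra_simps)
      finally show ?thesis .
    qed
    \<comment> \<open>The infima are taken one at a time, first over the parameter of
      \<open>z\<close>, then over that of \<open>x\<close>.\<close>
    have "q (x + z) - g x t \<le> q z" if "t \<ge> 0" for t
      using *[OF that] by (intro le_q) (simp add: algebra_simps)
    then have "q (x + z) - q z \<le> q x"
      by (intro le_q) (simp add: algebra_simps)
    then show "q (x + z) \<le> q x + q z" by simp
  next
    fix c :: real and x assume c: "0 \<le> c"
    show "q (c *\<^sub>R x) \<le> c * q x"
    proof (cases "c = 0")
      case True
      then show ?thesis using q_le[of 0 0] sublinear_zero[OF p] by (simp add: g_def)
    next
      case False
      have "q (c *\<^sub>R x) / c \<le> g x t" if "t \<ge> 0" for t
      proof -
        \<comment> \<open>Scaling the parameter along with the vector makes \<open>g\<close>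
          homogeneous.\<close>
        have "q (c *\<^sub>R x) \<le> g (c *\<^sub>R x) (c * t)" using that c by (intro q_le) auto
        also have "\<dots> = c * g x t"
          using sublinear_scaleR[OF p c, of "x + t *\<^sub>R y"] by (simp add: g_def algebra_simps)
        finally show ?thesis using c False by (simp add: field_simps)
      qed
      then have "q (c *\<^sub>R x) / c \<le> q x" by (rule le_q)
      then show ?thesis using c False by (simp add: field_simps)
    qed
  qed
qed

text \<open>Zorn's lemma applies because the pointwise infimum of a nonempty chain is again
  sublinear; it is finite since a sublinear functional below \<open>p\<close> is at least
  \<open>- p (- x)\<close> at \<open>x\<close>.\<close>

lemma minimal_sublinear_exists:
  assumes p: "sublinear p"
  obtains m where "sublinear m" "m \<le> p" "\<And>q. sublinear q \<Longrightarrow> q \<le> m \<Longrightarrow> q = m"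
proof -
  define A where "A = {q. sublinear q \<and> q \<le> p}"
  \<comment> \<open>The order is reversed because \<open>predicate_Zorn\<close> yields maximal
    elements.\<close>
  define P :: "('a \<Rightarrow> real) \<Rightarrow> ('a \<Rightarrow> real) \<Rightarrow> bool" where "P a b \<longleftrightarrow> b \<le> a" for a b
  have "partial_order_on A (relation_of P A)"
    by (rule partial_order_on_relation_ofI) (auto simp: P_def)
  moreover have "\<exists>u\<in>A. \<forall>a\<in>C. P a u" if C: "C \<in> Chains (relation_of P A)" for C
  proof (cases "C = {}")
    case True
    then show ?thesis using p by (auto simp: A_def)
  next
    case False
    have CA: "sublinear a" "a \<le> p" if "a \<in> C" for a
      using C that by (auto simp: Chains_def relation_of_def A_def)
    have tot: "a \<le> b \<or> b \<le> a" if "a \<in> C" "b \<in> C" for a b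
      using C that by (auto simp: Chains_def relation_of_def P_def)
    define u where "u x = (INF a\<in>C. a x)" for x
    have "- p (- x) \<le> a x" if "a \<in> C" for a x
      using sublinear_minus_le[OF CA(1)[OF that], of x] CA(2)[OF that]
      by (meson dual_order.trans le_funD neg_le_iff_le)
    then have bdd: "bdd_below ((\<lambda>a. a x) ` C)" for x
      by (auto intro!: bdd_belowI2)
    have u_le: "u x \<le> a x" if "a \<in> C" for a x
      unfolding u_def by (rule cINF_lower[OF bdd that])
    have le_u: "k \<le> u x" if "\<And>a. a \<in> C \<Longrightarrow> k \<le> a x" for k x
      unfolding u_def using that False by (intro cINF_greatest) auto
    have "sublinear u"
      unfolding sublinear_def
    proof (intro conjI allI impI)
      fix x z
      have *: "u (x + z) \<le> a x + b z" if ab: "a \<in> C" "b \<in> C" for a b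
      proof -
        \<comment> \<open>Subadditivity needs one functional for both summands; in a chain the
          smaller of \<open>a\<close> and \<open>b\<close> serves.\<close>
        have "\<exists>d\<in>C. d \<le> a \<and> d \<le> b" using tot[OF ab] ab by blast
        then obtain d where d: "d \<in> C" "d \<le> a" "d \<le> b" by blast
        have "u (x + z) \<le> d x + d z"
          using u_le[OF d(1)] sublinear_add[OF CA(1)[OF d(1)]] by (meson order_trans)
        also have "\<dots> \<le> a x + b z" using d by (intro add_mono) (auto simp: le_fun_def)
        finally show ?thesis .
      qed
      have "u (x + z) - a x \<le> u z" if "a \<in> C" for a
        using *[OF that] by (intro le_u) (simp add: algebra_simps)
      then have "u (x + z) - u z \<le> u x"
        by (intro le_u) (simp add: algebra_simps)
      then show "u (x + z) \<le> u x + u z" by simp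
    next
      fix c :: real and x assume c: "0 \<le> c"
      show "u (c *\<^sub>R x) \<le> c * u x"
      proof (cases "c = 0")
        case True
        then show ?thesis using False u_le[of _ 0] CA sublinear_zero by fastforce
      next
        case cn: False
        have "u (c *\<^sub>R x) / c \<le> a x" if "a \<in> C" for a
          using u_le[OF that, of "c *\<^sub>R x"] sublinear_scaleR[OF CA(1)[OF that] c, of x] c cn
          by (simp add: field_simps)
        then have "u (c *\<^sub>R x) / c \<le> u x" by (rule le_u)
        then show ?thesis using c cn by (simp add: field_simps)
      qed
    qed
    moreover have "u \<le> p"
      using False u_le CA(2) unfolding le_fun_def by (meson all_not_in_conv order_trans)
    ultimately show ?thesis
      using u_le by (intro bexI[of _ u]) (auto simp: A_def P_def le_fun_def)
  qed
  ultimately obtain m where m: "m \<in> A" "\<forall>a\<in>A. P m a \<longrightarrow> a = m"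
    using predicate_Zorn[of A P] by blast
  show thesis
  proof
    show "sublinear m" "m \<le> p" using m(1) by (auto simp: A_def)
    show "q = m" if "sublinear q" "q \<le> m" for q
      using m that \<open>m \<le> p\<close> by (auto simp: A_def P_def)
  qed
qed

text \<open>The lowering construction serves twice: applied to \<open>p\<close> it forces the value at
  \<open>y\<close>, and applied to a minimal functional it shows that this functional is odd, hence linear.\<close>

lemma hahn_banach_sublinear:
  fixes p :: "'a::real_vector \<Rightarrow> real"
  assumes p: "sublinear p"
  obtains f where "linear f" "\<And>x. f x \<le> p x" "f y = p y"
proof -
  obtain q where q: "sublinear q" "q \<le> p" "q (- y) \<le> - p y"
    using sublinear_lower[OF p] .
  obtain m where m: "sublinear m" "m \<le> q" and min: "\<And>r. sublinear r \<Longrightarrow> r \<le> m \<Longrightarrow> r = m"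
    using minimal_sublinear_exists[OF q(1)] by blast
  have neg: "m (- x) = - m x" for x
  proof -
    obtain r where r: "sublinear r" "r \<le> m" "r (- x) \<le> - m x"
      using sublinear_lower[OF m(1)] .
    then have "m (- x) \<le> - m x" using min by auto
    then show ?thesis using sublinear_minus_le[OF m(1), of x] by simp
  qed
  have "linear m"
  proof (rule linearI)
    fix x z
    show "m (x + z) = m x + m z"
      using sublinear_add[OF m(1), of x z] sublinear_add[OF m(1), of "- x" "- z"]
        neg[of x] neg[of z] neg[of "x + z"] by simp
  next
    fix c :: real and x
    show "m (c *\<^sub>R x) = c *\<^sub>R m x"
    proof (cases "c \<ge> 0")
      case True
      then show ?thesis using sublinear_scaleR[OF m(1)] by simp
    next
      case False
      then show ?thesis using sublinear_scaleR[OF m(1), of "- c" x] neg[of "c *\<^sub>R x"] by simp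
    qed
  qed
  moreover have le: "m x \<le> p x" for x
    using m(2) q(2) by (meson le_funD order_trans)
  moreover have "m y = p y"
    using le[of y] le_funD[OF m(2), of "- y"] q(3) neg[of y] by simp
  ultimately show thesis using that by blast
qed

section \<open>Complex functionals with real part dominated by a sublinear functional\<close>

lemma cdual_bounded_linear: "\<phi> \<in> cdual \<Longrightarrow> bounded_linear \<phi>"
  by (simp add: cdual_def)

lemma cdual_diff: "\<phi> \<in> cdual \<Longrightarrow> \<phi> (x - y) = \<phi> x - \<phi> y"
  by (simp add: bounded_linear.linear cdual_bounded_linear linear_diff)

lemma cdual_scaleR: "\<phi> \<in> cdual \<Longrightarrow> \<phi> (r *\<^sub>R x) = r *\<^sub>R \<phi> x"
  by (simp add: bounded_linear.linear cdual_bounded_linear linear_scale)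

text \<open>A real-linear \<open>f\<close> is the real part of the complex-linear functional with
  imaginary part \<open>- f (\<i> *\<^sub>C x)\<close>. Only the real part is compared with
  \<open>p\<close>, so real sublinearity of \<open>p\<close> suffices; domination by the norm
  supplies boundedness.\<close>

lemma hahn_banach_cdual:
  fixes p :: "'a::complex_normed_vector \<Rightarrow> real"
  assumes p: "sublinear p" and le: "\<And>x. p x \<le> norm x"
  obtains \<phi> where "\<phi> \<in> cdual" "\<And>x. Re (\<phi> x) \<le> p x" "Re (\<phi> y) = p y"
proof -
  obtain f where f: "linear f" "\<And>x. f x \<le> p x" "f y = p y"
    using hahn_banach_sublinear[OF p] by blast
  have f_abs: "\<bar>f x\<bar> \<le> norm x" for x
    using f(2)[of x] f(2)[of "- x"] le[of x] le[of "- x"] linear_neg[OF f(1), of x] by simp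
  define \<phi> where "\<phi> x = Complex (f x) (- f (\<i> *\<^sub>C x))" for x
  have scR: "\<i> *\<^sub>C r *\<^sub>R x = r *\<^sub>R \<i> *\<^sub>C x" for r :: real and x :: 'a
    by (simp add: scaleR_scaleC scaleC_scaleC mult.commute)
  have "linear \<phi>"
    by (rule linearI)
      (auto simp: \<phi>_def scaleC_add_right scR linear_add[OF f(1)] linear_scale[OF f(1)] complex_eq_iff)
  moreover have "norm (\<phi> x) \<le> norm x * 2" for x
  proof -
    have "norm (\<phi> x) \<le> \<bar>f x\<bar> + \<bar>f (\<i> *\<^sub>C x)\<bar>"
      using cmod_le[of "\<phi> x"] by (simp add: \<phi>_def)
    also have "\<dots> \<le> norm x * 2"
      using f_abs[of x] f_abs[of "\<i> *\<^sub>C x"] by (simp add: norm_scaleC)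
    finally show ?thesis .
  qed
  ultimately have bl: "bounded_linear \<phi>"
    by (auto simp: bounded_linear_def bounded_linear_axioms_def)
  \<comment> \<open>By real linearity, complex homogeneity reduces to the scalar
    \<open>\<i>\<close>.\<close>
  have "\<phi> (c *\<^sub>C x) = c * \<phi> x" for c x
  proof -
    have "c *\<^sub>C x = Re c *\<^sub>R x + Im c *\<^sub>R \<i> *\<^sub>C x"
      by (simp add: scaleR_scaleC scaleC_scaleC flip: scaleC_add_left)
        (metis complex_eq mult.commute)
    moreover have "\<i> *\<^sub>C \<i> *\<^sub>C x = - x"
      using scaleR_scaleC[of "-1" x] by (simp add: scaleC_scaleC)
    then have "\<phi> (\<i> *\<^sub>C x) = \<i> * \<phi> x"
      by (simp add: \<phi>_def complex_eq_iff linear_neg[OF f(1)])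
    ultimately have "\<phi> (c *\<^sub>C x) = Re c *\<^sub>R \<phi> x + Im c *\<^sub>R (\<i> * \<phi> x)"
      using \<open>linear \<phi>\<close> by (simp add: linear_add linear_scale)
    then show ?thesis by (simp add: complex_eq_iff)
  qed
  then have "\<phi> \<in> cdual" using bl by (simp add: cdual_def)
  then show thesis using that[of \<phi>] f by (simp add: \<phi>_def)
qed

text \<open>The norm itself is the dominating functional. Used at \<open>- x\<close> too, the bound
  on the real part controls its absolute value.\<close>

lemma norming_functional:
  fixes y :: "'a::complex_normed_vector"
  obtains \<phi> where "\<phi> \<in> cdual" "\<And>x. Re (\<phi> x) \<le> norm x" "Re (\<phi> y) = norm y"
proof -
  have "sublinear (norm :: 'a \<Rightarrow> real)"
    by (auto simp: sublinear_def norm_triangle_ineq)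
  then obtain \<phi> :: "'a \<Rightarrow> complex"
    where "\<phi> \<in> cdual" "\<And>x. Re (\<phi> x) \<le> norm x" "Re (\<phi> y) = norm y"
    using hahn_banach_cdual[of norm y] by blast
  then show thesis using that by blast
qed

section \<open>Distance to a subspace as a dominating functional\<close>

lemma infdist_less_obtain:
  assumes "A \<noteq> {}" "infdist x A < e"
  obtains a where "a \<in> A" "dist x a < e"
  using assms by (auto simp: infdist_notempty cINF_less_iff)

text \<open>Fed into \<open>hahn_banach_cdual\<close>, this distance yields a functional whose real
  part vanishes on \<open>S\<close> and equals the distance at a prescribed point. Subadditivity
  holds because the sum of near-optimal points of \<open>S\<close> is in \<open>S\<close>.\<close>

lemma sublinear_infdist_subspace:
  fixes S :: "'a::real_normed_vector set"
  assumes S: "subspace S"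
  shows "sublinear (\<lambda>x. infdist x S)"
  unfolding sublinear_def
proof (intro conjI allI impI)
  have ne: "S \<noteq> {}" using S subspace_0 by auto
  fix x y
  show "infdist (x + y) S \<le> infdist x S + infdist y S"
  proof (rule field_le_epsilon)
    fix e :: real assume "e > 0"
    obtain a where a: "a \<in> S" "dist x a < infdist x S + e / 2"
      using infdist_less_obtain[OF ne, of x "infdist x S + e / 2"] \<open>e > 0\<close> by auto
    obtain b where b: "b \<in> S" "dist y b < infdist y S + e / 2"
      using infdist_less_obtain[OF ne, of y "infdist y S + e / 2"] \<open>e > 0\<close> by auto
    have "infdist (x + y) S \<le> dist (x + y) (a + b)"
      using S a b by (intro infdist_le subspace_add)
    also have "\<dots> \<le> dist x a + dist y b" by (rule dist_triangle_add)
    finally show "infdist (x + y) S \<le> infdist x S + infdist y S + e" using a b by simp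
  qed
next
  have ne: "S \<noteq> {}" using S subspace_0 by auto
  fix c :: real and x :: 'a assume c: "0 \<le> c"
  show "infdist (c *\<^sub>R x) S \<le> c * infdist x S"
  proof (cases "c = 0")
    case True
    then show ?thesis using infdist_zero[OF subspace_0[OF S]] by simp
  next
    case False
    have scale: "dist (c *\<^sub>R x) (c *\<^sub>R a) = c * dist x a" for a
      using c by (simp add: dist_norm flip: scaleR_diff_right)
    have "infdist (c *\<^sub>R x) S / c \<le> dist x a" if "a \<in> S" for a
      using infdist_le[OF subspace_scale[OF S that, of c], of "c *\<^sub>R x"] c False
      by (simp add: scale field_simps)
    then have "infdist (c *\<^sub>R x) S / c \<le> infdist x S"
      unfolding infdist_notempty[OF ne] by (intro cINF_greatest[OF ne])
    then show ?thesis using c False by (simp add: field_simps)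
  qed
qed

subsection \<open>Weak sequential compactness\<close>

text \<open>Evaluation at the \<open>x n\<close> gives points of a product of discs, compact by
  Tychonoff. A cluster point there inherits linearity and the norm bound, hence lies in the bidual,
  and reflexivity represents it by a vector.\<close>

lemma weak_cluster_point:
  fixes x :: "nat \<Rightarrow> 'a::complex_banach"
  assumes refl: "reflexive_space TYPE('a)" and M: "\<And>n. norm (x n) \<le> M"
  obtains v where "\<And>\<phi> e. \<phi> \<in> cdual \<Longrightarrow> e > 0 \<Longrightarrow> \<exists>\<^sub>F n in sequentially. cmod (\<phi> (x n) - \<phi> v) < e"
proof -
  \<comment> \<open>The value 0 outside \<open>cdual\<close>, matched by the factor
    \<open>{0}\<close> in \<open>K\<close>, lets the product run over all functions.\<close>
  define J where "J n \<phi> = (if \<phi> \<in> cdual then \<phi> (x n) else 0)" for n and \<phi> :: "'a \<Rightarrow> complex"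
  define K where "K \<phi> = (if \<phi> \<in> cdual then cball (0 :: complex) (M * onorm \<phi>) else {0})"
    for \<phi> :: "'a \<Rightarrow> complex"
  have "compactin euclidean (PiE UNIV K)"
    unfolding euclidean_product_topology[symmetric] compactin_PiE by (auto simp: K_def)
  then have "compact (PiE UNIV K)" by (simp only: compactin_euclidean_iff)
  moreover have "J n \<in> PiE UNIV K" for n
  proof -
    have "cmod (\<phi> (x n)) \<le> M * onorm \<phi>" if "\<phi> \<in> cdual" for \<phi>
    proof -
      have "cmod (\<phi> (x n)) \<le> onorm \<phi> * norm (x n)"
        using cdual_bounded_linear[OF that] by (rule onorm)
      also have "\<dots> \<le> M * onorm \<phi>"
        using M[of n] onorm_pos_le[OF cdual_bounded_linear[OF that]]
        by (subst mult.commute) (rule mult_right_mono)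
      finally show ?thesis .
    qed
    then show ?thesis by (auto simp: J_def K_def)
  qed
  then have "eventually (\<lambda>\<Psi>. \<Psi> \<in> PiE UNIV K) (filtermap J sequentially)"
    unfolding eventually_filtermap by (intro always_eventually allI)
  moreover have "filtermap J sequentially \<noteq> bot"
    by (simp add: filtermap_bot_iff)
  ultimately obtain \<Phi> where \<Phi>: "inf (nhds \<Phi>) (filtermap J sequentially) \<noteq> bot" "\<Phi> \<in> PiE UNIV K"
    unfolding compact_filter by blast
  have freq: "\<exists>\<^sub>F n in sequentially. J n \<in> U" if "open U" "\<Phi> \<in> U" for U
  proof (rule ccontr)
    assume "\<not> ?thesis"
    then have "eventually (\<lambda>\<Psi>. \<Psi> \<notin> U) (filtermap J sequentially)"
      by (simp add: not_frequently eventually_filtermap)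
    moreover have "eventually (\<lambda>\<Psi>. \<Psi> \<in> U) (nhds \<Phi>)"
      using that by (rule eventually_nhds_in_open)
    ultimately have "eventually (\<lambda>_. False) (inf (nhds \<Phi>) (filtermap J sequentially))"
      unfolding eventually_inf by blast
    then show False using \<Phi>(1) by (simp add: trivial_limit_def)
  qed
  \<comment> \<open>Each linearity relation is a closed condition in finitely many coordinates, so
    it passes from the \<open>J n\<close> to the cluster point.\<close>
  have closed: "\<Phi> \<in> T" if "closed T" "\<And>n. J n \<in> T" for T
    using freq[of "- T"] that by (auto simp: open_closed)
  have coord: "continuous_on UNIV (\<lambda>\<Psi> :: ('a \<Rightarrow> complex) \<Rightarrow> complex. \<Psi> \<phi>)" for \<phi>
    by (rule continuous_on_product_coordinates)
  have "\<Phi> \<in> cbidual"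
    unfolding cbidual_def
  proof (intro CollectI conjI ballI allI)
    fix \<phi> \<psi> :: "'a \<Rightarrow> complex" assume *: "\<phi> \<in> cdual" "\<psi> \<in> cdual"
    have "(\<lambda>x. \<phi> x + \<psi> x) \<in> cdual"
      using * by (auto simp: cdual_def algebra_simps intro: bounded_linear_add)
    then have "\<Phi> \<in> {\<Psi>. \<Psi> (\<lambda>x. \<phi> x + \<psi> x) = \<Psi> \<phi> + \<Psi> \<psi>}"
      using * by (intro closed closed_Collect_eq continuous_intros coord) (auto simp: J_def)
    then show "\<Phi> (\<lambda>x. \<phi> x + \<psi> x) = \<Phi> \<phi> + \<Phi> \<psi>" by simp
  next
    fix c and \<phi> :: "'a \<Rightarrow> complex" assume *: "\<phi> \<in> cdual"
    have "(\<lambda>x. c * \<phi> x) \<in> cdual"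
      using * by (auto simp: cdual_def algebra_simps intro: bounded_linear_const_mult)
    then have "\<Phi> \<in> {\<Psi>. \<Psi> (\<lambda>x. c * \<phi> x) = c * \<Psi> \<phi>}"
      using * by (intro closed closed_Collect_eq continuous_intros coord) (auto simp: J_def)
    then show "\<Phi> (\<lambda>x. c * \<phi> x) = c * \<Phi> \<phi>" by simp
  next
    show "\<exists>K. \<forall>\<phi>\<in>cdual. cmod (\<Phi> \<phi>) \<le> K * onorm \<phi>"
    proof (intro exI ballI)
      fix \<phi> :: "'a \<Rightarrow> complex" assume "\<phi> \<in> cdual"
      then show "cmod (\<Phi> \<phi>) \<le> M * onorm \<phi>"
        using PiE_mem[OF \<Phi>(2), of \<phi>] by (simp add: K_def)
    qed
  qed
  then obtain v where v: "\<And>\<phi>. \<phi> \<in> cdual \<Longrightarrow> \<Phi> \<phi> = \<phi> v"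
    using refl unfolding reflexive_space_def by blast
  show thesis
  proof
    fix \<phi> :: "'a \<Rightarrow> complex" and e :: real assume *: "\<phi> \<in> cdual" "e > 0"
    have "open {\<Psi>. cmod (\<Psi> \<phi> - \<phi> v) < e}"
      by (intro open_Collect_less continuous_intros coord)
    from freq[OF this] show "\<exists>\<^sub>F n in sequentially. cmod (\<phi> (x n) - \<phi> v) < e"
      using * v by (simp add: J_def)
  qed
qed

text \<open>Real coefficients are replaced by rational ones, one generator at a time. Lists of pairs
  from \<open>rat\<close> and \<open>nat\<close> form a countable type, so these combinations can
  index a countable family of functionals.\<close>

lemma rational_combinations_dense:
  fixes x :: "nat \<Rightarrow> 'a::real_normed_vector"
  assumes "y \<in> span (range x)" "e > 0"
  shows "\<exists>l. norm (y - (\<Sum>(q, k)\<leftarrow>l. of_rat q *\<^sub>R x k)) < e"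
  using assms
proof (induction arbitrary: e rule: span_induct_alt)
  case base
  then show ?case by (intro exI[of _ "[]"]) simp
next
  case (step c a y)
  then obtain k where k: "a = x k" by auto
  obtain l where l: "norm (y - (\<Sum>(q, k)\<leftarrow>l. of_rat q *\<^sub>R x k)) < e / 2"
    using step.IH[of "e / 2"] step.prems by auto
  \<comment> \<open>This tolerance makes the error in the new coefficient cost at most
    \<open>e / 2\<close>; the \<open>+ 1\<close> covers \<open>a = 0\<close>.\<close>
  define d where "d = e / 2 / (norm a + 1)"
  have "d > 0" using step.prems by (simp add: d_def add_nonneg_pos)
  then obtain q where q: "c < of_rat q" "of_rat q < c + d"
    using of_rat_dense[of c "c + d"] by auto
  have "norm ((c - of_rat q) *\<^sub>R a) \<le> d * norm a"
    using q by (auto intro!: mult_right_mono)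
  also have "\<dots> \<le> d * (norm a + 1)" using \<open>d > 0\<close> by simp
  also have "\<dots> = e / 2"
  proof -
    have "norm a + 1 \<noteq> 0" using norm_ge_zero[of a] by linarith
    then show ?thesis unfolding d_def by (rule nonzero_eq_divide_eq[THEN iffD1, OF _ refl])
  qed
  finally have "norm ((c - of_rat q) *\<^sub>R a + (y - (\<Sum>(q, k)\<leftarrow>l. of_rat q *\<^sub>R x k))) < e"
    using l by (intro order_le_less_trans[OF norm_triangle_ineq]) simp
  then show ?case
    by (intro exI[of _ "(q, k) # l"]) (simp add: k algebra_simps)
qed

text \<open>Countably many functionals separate the points of the closure of the span. Once their
  real parts converge along \<open>r\<close>, every further subsequence has the same weak cluster
  point, which forces weak convergence.\<close>

lemma bounded_seq_weakly_convergent_subseq: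
  fixes x :: "nat \<Rightarrow> 'a::complex_banach"
  assumes refl: "reflexive_space TYPE('a)" and M: "\<And>n. norm (x n) \<le> M"
  obtains r v where "strict_mono r" "weakly_converges (x \<circ> r) v"
proof -
  define S where "S = span (range x)"
  define comb where "comb l = (\<Sum>(q, k)\<leftarrow>l. of_rat q *\<^sub>R x k)" for l
  have "\<exists>\<phi>\<in>cdual. (\<forall>w. Re (\<phi> w) \<le> norm w) \<and> Re (\<phi> (comb l)) = norm (comb l)" for l
    using norming_functional[of "comb l"] by metis
  then obtain P where P: "\<And>l. P l \<in> cdual" "\<And>l w. Re (P l w) \<le> norm w"
    "\<And>l. Re (P l (comb l)) = norm (comb l)"
    by metis
  have P_abs: "\<bar>Re (P l w)\<bar> \<le> norm w" for l w
    using P(2)[of l w] P(2)[of l "- w"] cdual_scaleR[OF P(1)[of l], of "-1" w] by simp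
  define F where "F n l = Re (P l (x n))" for n l
  \<comment> \<open>This replaces the diagonal extraction: over a countable index type the compact
    product is sequentially compact.\<close>
  have "compactin euclidean (PiE UNIV (\<lambda>_ :: (rat \<times> nat) list. {- M..M}))"
    unfolding euclidean_product_topology[symmetric] compactin_PiE by auto
  then have "seq_compact (PiE UNIV (\<lambda>_ :: (rat \<times> nat) list. {- M..M}))"
    by (intro compact_imp_seq_compact) (simp only: compactin_euclidean_iff)
  moreover have "F n l \<in> {- M..M}" for n l
    using P_abs[of l "x n"] M[of n] by (auto simp: F_def)
  then have "\<forall>n. F n \<in> PiE UNIV (\<lambda>_. {- M..M})" by auto
  ultimately obtain L r where r: "strict_mono r" "(F \<circ> r) \<longlonglongrightarrow> L"
    by (rule seq_compactE)
  have L: "(\<lambda>n. Re (P l (x (r n)))) \<longlonglongrightarrow> L l" for l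
    using continuous_on_tendsto_compose[OF continuous_on_product_coordinates[of l] r(2)]
    by (simp add: F_def o_def)
  \<comment> \<open>An arbitrary further subsequence \<open>s\<close> is allowed, since convergence
    is later refuted along a subsequence.\<close>
  have cluster: "\<exists>v. infdist v S = 0 \<and> (\<forall>l. Re (P l v) = L l) \<and>
      (\<forall>\<phi>\<in>cdual. \<forall>e>0. \<exists>\<^sub>F n in sequentially. cmod (\<phi> (x (r (s n))) - \<phi> v) < e)"
    if s: "strict_mono s" for s
  proof -
    obtain v where v: "\<And>\<phi> e. \<phi> \<in> cdual \<Longrightarrow> e > 0 \<Longrightarrow>
        \<exists>\<^sub>F n in sequentially. cmod (\<phi> (x (r (s n))) - \<phi> v) < e"
      using weak_cluster_point[OF refl, of "\<lambda>n. x (r (s n))" M] M by blast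
    have lim_unique: "Re (\<phi> v) = b"
      if \<phi>: "\<phi> \<in> cdual" and lim: "(\<lambda>n. Re (\<phi> (x (r n)))) \<longlonglongrightarrow> b" for \<phi> b
    proof (rule ccontr)
      assume "Re (\<phi> v) \<noteq> b"
      then have e: "\<bar>Re (\<phi> v) - b\<bar> / 2 > 0" (is "?e > 0") by simp
      have "(\<lambda>n. Re (\<phi> (x (r (s n))))) \<longlonglongrightarrow> b"
        using LIMSEQ_subseq_LIMSEQ[OF lim s] by (simp add: o_def)
      then have "\<forall>\<^sub>F n in sequentially. dist (Re (\<phi> (x (r (s n))))) b < ?e"
        using e by (rule tendstoD)
      with v[OF \<phi> e] have "\<exists>\<^sub>F n in sequentially. cmod (\<phi> (x (r (s n))) - \<phi> v) < ?e \<and>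
          dist (Re (\<phi> (x (r (s n))))) b < ?e"
        by (rule frequently_eventually_frequently)
      from frequently_ex[OF this]
      obtain n where n: "cmod (\<phi> (x (r (s n))) - \<phi> v) < ?e"
          "dist (Re (\<phi> (x (r (s n))))) b < ?e"
        by blast
      then show False
        using abs_Re_le_cmod[of "\<phi> (x (r (s n))) - \<phi> v"]
          dist_triangle3[of "Re (\<phi> v)" b "Re (\<phi> (x (r (s n))))"]
        unfolding dist_real_def minus_complex.sel by argo
    qed
    \<comment> \<open>The real part of this functional vanishes along the sequence, so it vanishes
      at \<open>v\<close>, where it equals the distance to \<open>S\<close>.\<close>
    obtain \<phi> where \<phi>: "\<phi> \<in> cdual" "\<And>w. Re (\<phi> w) \<le> infdist w S" "Re (\<phi> v) = infdist v S"
    proof (rule hahn_banach_cdual[of "\<lambda>w. infdist w S" v])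
      show "sublinear (\<lambda>w. infdist w S)"
        unfolding S_def by (rule sublinear_infdist_subspace[OF subspace_span])
      show "infdist w S \<le> norm w" for w
        using infdist_le[of 0 S w] by (simp add: S_def span_zero)
    qed blast
    have "Re (\<phi> (x n)) = 0" for n
    proof -
      have "x n \<in> S" "- x n \<in> S" by (auto simp: S_def span_base span_neg)
      then show ?thesis
        using \<phi>(2)[of "x n"] \<phi>(2)[of "- x n"] cdual_scaleR[OF \<phi>(1), of "-1" "x n"] by simp
    qed
    then have "infdist v S = 0" using lim_unique[OF \<phi>(1), of 0] \<phi>(3) by simp
    then show ?thesis using v lim_unique[OF P(1) L] by blast
  qed
  \<comment> \<open>Choose \<open>comb l\<close> close to \<open>v - w\<close>. The real part of
    \<open>P l\<close> vanishes at \<open>v - w\<close> and norms \<open>comb l\<close>, so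
    \<open>norm (comb l)\<close> is at most \<open>norm (v - w - comb l)\<close>. Three errors of
    \<open>e / 6\<close> make the latter less than \<open>e / 2\<close>, and the triangle inequality
    doubles this.\<close>
  have unique: "v = w" if v: "infdist v S = 0" "\<forall>l. Re (P l v) = L l"
    and w: "infdist w S = 0" "\<forall>l. Re (P l w) = L l" for v w
  proof -
    have "norm (v - w) \<le> 0 + e" if "e > 0" for e
    proof -
      have ne: "S \<noteq> {}" using span_zero by (auto simp: S_def)
      obtain a where a: "a \<in> S" "dist v a < e / 6"
        using infdist_less_obtain[OF ne, of v "e / 6"] v(1) \<open>e > 0\<close> by auto
      obtain b where b: "b \<in> S" "dist w b < e / 6"
        using infdist_less_obtain[OF ne, of w "e / 6"] w(1) \<open>e > 0\<close> by auto
      obtain l where l: "norm (a - b - comb l) < e / 6"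
        using rational_combinations_dense[of "a - b" x "e / 6"] a b \<open>e > 0\<close>
        unfolding comb_def S_def by (auto intro: span_diff)
      have "v - w - comb l = (v - a) - (w - b) + (a - b - comb l)" by simp
      also have "norm \<dots> \<le> norm (v - a) + norm (w - b) + norm (a - b - comb l)"
        by (intro norm_triangle_le add_right_mono norm_triangle_ineq4)
      also have "\<dots> < e / 2" using a b l by (simp add: dist_norm)
      finally have *: "norm (v - w - comb l) < e / 2" .
      have "Re (P l (v - w - comb l)) = - norm (comb l)"
        using v(2) w(2) P(3)[of l] by (simp add: cdual_diff[OF P(1)])
      then have "norm (comb l) \<le> norm (v - w - comb l)"
        using P_abs[of l "v - w - comb l"] by simp
      then show ?thesis
        using * norm_triangle_ineq[of "v - w - comb l" "comb l"] by simp
    qed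
    then have "norm (v - w) \<le> 0" by (rule field_le_epsilon)
    then show ?thesis by simp
  qed
  obtain v where v: "infdist v S = 0" "\<forall>l. Re (P l v) = L l"
    using cluster[of id] by (auto simp: strict_mono_def)
  have "(\<lambda>n. \<phi> (x (r n))) \<longlonglongrightarrow> \<phi> v" if \<phi>: "\<phi> \<in> cdual" for \<phi>
  proof (rule tendstoI, rule ccontr)
    fix e :: real
    assume "e > 0" "\<not> (\<forall>\<^sub>F n in sequentially. dist (\<phi> (x (r n))) (\<phi> v) < e)"
    \<comment> \<open>A subsequence staying at distance at least \<open>e\<close> under
      \<open>\<phi>\<close> still has a weak cluster point, which must be \<open>v\<close>.\<close>
    then obtain s :: "nat \<Rightarrow> nat"
      where s: "strict_mono s" "\<And>n. \<not> dist (\<phi> (x (r (s n)))) (\<phi> v) < e"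
      using not_eventually_sequentiallyD by blast
    obtain w where w: "infdist w S = 0" "\<forall>l. Re (P l w) = L l"
      "\<forall>\<phi>\<in>cdual. \<forall>e>0. \<exists>\<^sub>F n in sequentially. cmod (\<phi> (x (r (s n))) - \<phi> w) < e"
      using cluster[OF s(1)] by blast
    have "w = v" using unique v w by blast
    then have "\<exists>\<^sub>F n in sequentially. cmod (\<phi> (x (r (s n))) - \<phi> v) < e"
      using w(3) \<phi> \<open>e > 0\<close> by blast
    from frequently_ex[OF this] obtain n where "cmod (\<phi> (x (r (s n))) - \<phi> v) < e" by blast
    then show False using s(2)[of n] by (simp add: dist_norm)
  qed
  then show thesis using that[OF r(1), of v] by (simp add: weakly_converges_def)
qed

section \<open>Weak limits and maximizing sequences\<close>

lemma weakly_converges_subseq: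
  "weakly_converges xs x \<Longrightarrow> strict_mono r \<Longrightarrow> weakly_converges (xs \<circ> r) x"
  unfolding weakly_converges_def using LIMSEQ_subseq_LIMSEQ by (fastforce simp: o_def)

lemma weakly_converges_scaleR:
  assumes "weakly_converges xs x" shows "weakly_converges (\<lambda>n. c *\<^sub>R xs n) (c *\<^sub>R x)"
  using assms unfolding weakly_converges_def
  by (auto simp: cdual_scaleR intro!: tendsto_intros)

text \<open>Test against a functional norming the limit. The bounding sequence \<open>b\<close>
  covers both a constant bound and convergent norms.\<close>

lemma weak_limit_norm_le:
  assumes lim: "weakly_converges xs x" and le: "\<And>n. norm (xs n) \<le> b n" and b: "b \<longlonglongrightarrow> \<rho>"
  shows "norm x \<le> \<rho>"
proof -
  obtain \<phi> where \<phi>: "\<phi> \<in> cdual" "\<And>w. Re (\<phi> w) \<le> norm w" "Re (\<phi> x) = norm x"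
    using norming_functional[of x] by blast
  have "(\<lambda>n. Re (\<phi> (xs n))) \<longlonglongrightarrow> Re (\<phi> x)"
    using lim \<phi>(1) by (auto simp: weakly_converges_def intro: tendsto_Re)
  moreover have "Re (\<phi> (xs n)) \<le> b n" for n
    using \<phi>(2)[of "xs n"] le[of n] by simp
  ultimately show ?thesis
    using LIMSEQ_le[OF _ b] \<phi>(3) by auto
qed

lemma maximizing_sequence:
  fixes g :: "'a \<Rightarrow> real"
  assumes "A \<noteq> {}" and bdd: "bdd_above (g ` A)"
  obtains x where "\<And>n. x n \<in> A" "(\<lambda>n. g (x n)) \<longlonglongrightarrow> (SUP a\<in>A. g a)"
proof -
  have "\<exists>a\<in>A. (SUP a\<in>A. g a) - inverse (real (Suc n)) < g a" for n
    using less_cSUP_iff[OF assms, of "(SUP a\<in>A. g a) - inverse (real (Suc n))"] by simp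
  then obtain x where x: "\<And>n. x n \<in> A"
    "\<And>n. (SUP a\<in>A. g a) - inverse (real (Suc n)) < g (x n)" by metis
  have "(\<lambda>n. g (x n)) \<longlonglongrightarrow> (SUP a\<in>A. g a)"
  proof (rule tendsto_sandwich)
    show "(\<lambda>n. (SUP a\<in>A. g a) - inverse (real (Suc n))) \<longlonglongrightarrow> (SUP a\<in>A. g a)"
      using tendsto_diff[OF tendsto_const LIMSEQ_inverse_real_of_nat] by simp
    show "\<forall>\<^sub>F n in sequentially. g (x n) \<le> (SUP a\<in>A. g a)"
      using cSUP_upper[OF x(1) bdd] by simp
  qed (use x(2) in \<open>auto intro!: always_eventually less_imp_le\<close>)
  then show thesis using that x(1) by blast
qed

section \<open>Attainment of the s-norms and of the v-norm\<close>

theorem proposition2p1: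
  fixes f :: "'a::complex_banach \<Rightarrow> complex"
  assumes "reflexive_space TYPE('a)"
    and "weakly_seq_continuous f"
    and "bounded (f ` ball 0 1)"
  shows "(\<forall>s\<in>{0<..1}. attains_s_norm s f) \<and> attains_v_norm f"
proof (intro conjI ballI)
  obtain B where "\<forall>z\<in>f ` ball 0 1. cmod z \<le> B"
    using assms(3) unfolding bounded_iff by blast
  then have B: "cmod (f x) \<le> B" if "norm x < 1" for x
    using that by simp
  have cont: "(\<lambda>n. f (xs n)) \<longlonglongrightarrow> f x" if "weakly_converges xs x" for xs x
    using assms(2) that by (auto simp: weakly_seq_continuous_def)
  have ne: "ball (0::'a) 1 \<noteq> {}" by simp
  {
    fix s :: real assume s: "s \<in> {0<..1}"
    have "norm (s *\<^sub>R x) < 1" if "norm x < 1" for x :: 'a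
      using s that mult_left_le_one_le[of "norm x" s] by simp
    then have "bdd_above ((\<lambda>x. cmod (f (s *\<^sub>R x))) ` ball 0 1)"
      by (auto intro!: bdd_aboveI2[where M=B] B)
    then obtain x where x: "\<And>n. x n \<in> ball 0 1" "(\<lambda>n. cmod (f (s *\<^sub>R x n))) \<longlonglongrightarrow> s_norm s f"
      unfolding s_norm_def using maximizing_sequence[OF ne] by blast
    obtain r v where r: "strict_mono r" and v: "weakly_converges (x \<circ> r) v"
      using bounded_seq_weakly_convergent_subseq[OF assms(1), of x 1] x(1)
      by (auto simp: less_imp_le)
    \<comment> \<open>The weak limit may lie on the unit sphere, which \<open>attains_s_norm\<close>
      admits.\<close>
    have "norm v \<le> 1"
      by (rule weak_limit_norm_le[OF v _ tendsto_const]) (use x(1) in \<open>auto simp: less_imp_le\<close>)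
    have "(\<lambda>n. cmod (f (s *\<^sub>R x (r n)))) \<longlonglongrightarrow> cmod (f (s *\<^sub>R v))"
      using tendsto_norm[OF cont[OF weakly_converges_scaleR[OF v, of s]]] by simp
    moreover have "(\<lambda>n. cmod (f (s *\<^sub>R x (r n)))) \<longlonglongrightarrow> s_norm s f"
      using LIMSEQ_subseq_LIMSEQ[OF x(2) r] by (simp add: o_def)
    ultimately have "s_norm s f = cmod (f (s *\<^sub>R v))" using LIMSEQ_unique by blast
    then show "attains_s_norm s f"
      using \<open>norm v \<le> 1\<close> by (auto simp: attains_s_norm_def)
  }
  define g where "g x = (1 - (norm x)\<^sup>2) * cmod (f x)" for x
  have "g x \<le> B" if "norm x < 1" for x
  proof -
    have "g x \<le> 1 * cmod (f x)"
      unfolding g_def by (intro mult_right_mono) auto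
    then show ?thesis using B[OF that] by simp
  qed
  then have bdd: "bdd_above (g ` ball 0 1)"
    by (auto intro!: bdd_aboveI2[where M=B])
  have v_norm: "v_norm f = (SUP x\<in>ball 0 1. g x)"
    by (simp add: v_norm_def g_def)
  obtain x where x: "\<And>n. x n \<in> ball 0 1" "(\<lambda>n. g (x n)) \<longlonglongrightarrow> v_norm f"
    unfolding v_norm using maximizing_sequence[OF ne bdd] by blast
  obtain r v where r: "strict_mono r" and v: "weakly_converges (x \<circ> r) v"
    using bounded_seq_weakly_convergent_subseq[OF assms(1), of x 1] x(1)
    by (auto simp: less_imp_le)
  \<comment> \<open>The norm need not converge to \<open>norm v\<close> under weak convergence, so a
    further subsequence is taken along which the norms tend to some \<open>\<rho>\<close>.\<close>
  have "\<forall>n. norm (x (r n)) \<in> {0..1}" using x(1) by (simp add: less_imp_le)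
  from seq_compactE[OF compact_imp_seq_compact[OF compact_Icc] this]
  obtain \<rho> s where s: "strict_mono s" and \<rho>: "(\<lambda>n. norm (x (r (s n)))) \<longlonglongrightarrow> \<rho>"
    unfolding o_def by metis
  have w: "weakly_converges (\<lambda>n. x (r (s n))) v"
    using weakly_converges_subseq[OF v s] by (simp add: o_def)
  have v_le: "norm v \<le> \<rho>" by (rule weak_limit_norm_le[OF w order_refl \<rho>])
  have "norm (x (r (s n))) \<le> 1" for n using x(1)[of "r (s n)"] by simp
  then have "\<rho> \<le> 1" using LIMSEQ_le_const2[OF \<rho>] by blast
  have "(\<lambda>n. g (x (r (s n)))) \<longlonglongrightarrow> (1 - \<rho>\<^sup>2) * cmod (f v)"
    unfolding g_def by (intro tendsto_intros \<rho> cont[OF w])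
  moreover have "(\<lambda>n. g (x (r (s n)))) \<longlonglongrightarrow> v_norm f"
    using LIMSEQ_subseq_LIMSEQ[OF x(2) strict_mono_o[OF r s]] by (simp add: o_def)
  ultimately have "v_norm f = (1 - \<rho>\<^sup>2) * cmod (f v)" using LIMSEQ_unique by blast
  \<comment> \<open>Lower semicontinuity helps here: \<open>norm v \<le> \<rho>\<close> can only
    increase the weight.\<close>
  also have "\<dots> \<le> g v"
    unfolding g_def using v_le by (intro mult_right_mono) (auto intro: power_mono)
  finally have "v_norm f \<le> g v" .
  moreover have "g v \<le> v_norm f"
  \<comment> \<open>The supremum runs over the open ball, so a \<open>v\<close> on the sphere is
    treated separately: there \<open>g v = 0 \<le> g 0\<close>.\<close>
  proof (cases "norm v = 1")
    case True
    have "0 \<le> g 0" by (simp add: g_def)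
    also have "\<dots> \<le> v_norm f" unfolding v_norm by (intro cSUP_upper bdd) simp
    finally show ?thesis using True by (simp add: g_def)
  next
    case False
    then show ?thesis
      unfolding v_norm using v_le \<open>\<rho> \<le> 1\<close> by (intro cSUP_upper bdd) simp
  qed
  ultimately show "attains_v_norm f"
    using v_le \<open>\<rho> \<le> 1\<close> by (auto simp: attains_v_norm_def g_def intro!: bexI[of _ v])
qed

end
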